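(* Let $\mathcal M=(|\mathcal M|,F_{\mathcal M},w_{\mathcal M})$ be a connected mapping schema whose unique cycle contains at least one critical vertex. Let $f\in\mathcal P^{\mathcal M}$ be post-critically finite, and let $|S|\subset|\mathcal M|\times\mathbf C$ be a finite set with $f(|S|)\subset|S|$ containing all critical points of $f$. Let $S=(|S|,f,w_f)$ be the corresponding post-critical schema, with $d_S=w_f+1$, let $\phi:|S|\to|\mathcal M|$ be the canonical projection (sending a point of $\{u\}\times\mathbf C$ to $u$), and let $W(u)=\phi^{-1}(u)$. Then: (a) for every $u\in|\mathcal M|$ and every $v\in W(F_{\mathcal M}(u))$, $$\sum_{\{v'\in W(u)\,:\,f(v')=v\}} d_S(v')\ \le\ d_{\mathcal M}(u);$$ (b) for every $k\ge 1$, the number of disjoint periodic orbits in $S$ of return period $k$ is less than or equal to $N(n(\mathcal M),k)$.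
   Context: A mapping schema $S=(|S|,F,w)$ is a finite set $|S|$ of vertices, a map $F:|S|\to|S|$, and a weight $w(v)\in\mathbb Z_{\ge 0}$ for each vertex; the degree of a vertex is $d(v)=w(v)+1$, and $v$ is critical if $w(v)\ge1$. View it as a graph with one directed edge from each $v$ to $F(v)$; it is connected if this graph is connected (it then contains exactly one cycle). Given a schema $\mathcal M$ in which every cycle contains a critical vertex, $\mathcal P^{\mathcal M}$ is the space of maps $f$ from the disjoint union $|\mathcal M|\times\mathbf C$ of copies of $\mathbf C$ to itself such that $f$ restricted to each $\{u\}\times\mathbf C$ is a monic centered polynomial of degree $d_{\mathcal M}(u)=w_{\mathcal M}(u)+1$ with values in $\{F_{\mathcal M}(u)\}\times\mathbf C$. The map $f$ is post-critically finite if every critical point of $f$ is eventually mapped to a periodic cycle. For a post-critically finite $f$ and a finite forward-invariant set $|S|$ containing all critical points of $f$, the associated post-critical schema is $S=(|S|,f|_{|S|},w_f)$, where $w_f(v)+1$ is the local degree of $f$ at $v$. For $\mathcal M$ connected, $n(\mathcal M)$ is the product of the degrees $d_{\mathcal M}(u)$ over the vertices $u$ of the unique cycle of $\mathcal M$. The return period of a periodic vertex $v\in|S|$ is the period of $v$ divided by the number of vertices of the cycle of $\mathcal M$ (equivalently, the number of points of the orbit of $v$ lying in $W(\phi(v))$). For $n\ge2$, $k\ge1$, $N(n,k)$ is the number of distinct periodic orbits of exact period $k$ of the polynomial $z\mapsto z^n$ on $\mathbf C$. *)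

theory Defs
  imports
    Complex_Main
    "HOL-Computational_Algebra.Polynomial"
    "HOL-Combinatorics.Orbits"
    "Graph_Theory.Digraph_Component"
begin

record 'v mapping_schema =
  vertices :: "'v set"
  vmap :: "'v \<Rightarrow> 'v"
  weight :: "'v \<Rightarrow> nat"

text \<open>The values of \<open>vmap\<close> and \<open>weight\<close> outside \<open>vertices\<close> are irrelevant.\<close>

definition mapping_schema :: "'v mapping_schema \<Rightarrow> bool" where
  "mapping_schema M \<longleftrightarrow> finite (vertices M) \<and> vmap M ` vertices M \<subseteq> vertices M"

definition degree_at :: "'v mapping_schema \<Rightarrow> 'v \<Rightarrow> nat" where
  "degree_at M v = weight M v + 1"

definition critical_vertex :: "'v mapping_schema \<Rightarrow> 'v \<Rightarrow> bool" where
  "critical_vertex M v \<longleftrightarrow> v \<in> vertices M \<and> weight M v \<ge> 1"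

text \<open>Each vertex \<open>v\<close> also serves as the name of the arc from \<open>v\<close> to \<open>vmap M v\<close>.\<close>

definition schema_graph :: "'v mapping_schema \<Rightarrow> ('v, 'v) pre_digraph" where
  "schema_graph M = \<lparr>verts = vertices M, arcs = vertices M, tail = (\<lambda>v. v), head = vmap M\<rparr>"

definition connected_schema :: "'v mapping_schema \<Rightarrow> bool" where
  "connected_schema M \<longleftrightarrow> Digraph_Component.connected (schema_graph M)"

text \<open>
  \<^const>\<open>orbit\<close> collects the iterates \<open>(g ^^ n) x\<close> with \<open>n \<ge> 1\<close>, so \<open>cyclic_on g C\<close>
  (\<open>C = orbit g x\<close> for some \<open>x \<in> C\<close>) says that \<open>C\<close> is the orbit of a periodic point of \<open>g\<close>.
  Since every vertex of a schema has exactly one outgoing arc, these are also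
  the vertex sets of the directed cycles of its graph.
\<close>

definition periodic_orbits :: "('a \<Rightarrow> 'a) \<Rightarrow> 'a set \<Rightarrow> 'a set set" where
  "periodic_orbits g A = {C. C \<subseteq> A \<and> cyclic_on g C}"

definition exact_period :: "('a \<Rightarrow> 'a) \<Rightarrow> 'a \<Rightarrow> nat" where
  "exact_period g x = (LEAST k. 0 < k \<and> (g ^^ k) x = x)"

text \<open>Meaningful only for schemas with exactly one cycle, in particular for connected ones.\<close>

definition unique_cycle :: "'v mapping_schema \<Rightarrow> 'v set" where
  "unique_cycle M = (THE C. C \<in> periodic_orbits (vmap M) (vertices M))"

definition cycle_degree :: "'v mapping_schema \<Rightarrow> nat" where
  "cycle_degree M = (\<Prod>u\<in>unique_cycle M. degree_at M u)"

definition monic_centered :: "nat \<Rightarrow> complex poly \<Rightarrow> bool" where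
  "monic_centered d p \<longleftrightarrow> degree p = d \<and> lead_coeff p = 1 \<and> coeff p (d - 1) = 0"

text \<open>
  A self-map of \<open>vertices M \<times> \<complex>\<close> is represented by a function on the whole type
  \<^typ>\<open>'v \<times> complex\<close> whose values outside \<open>vertices M \<times> UNIV\<close> are irrelevant.
  For \<open>d = 1\<close> the only monic centered polynomial is the identity.
\<close>

definition poly_maps :: "'v mapping_schema \<Rightarrow> ('v \<times> complex \<Rightarrow> 'v \<times> complex) set" where
  "poly_maps M = {f. \<forall>u\<in>vertices M. \<exists>p. monic_centered (degree_at M u) p \<and>
                       (\<forall>z. f (u, z) = (vmap M u, poly p z))}"

definition fibre_poly :: "('v \<times> complex \<Rightarrow> 'v \<times> complex) \<Rightarrow> 'v \<Rightarrow> complex poly" where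
  "fibre_poly f u = (THE p. \<forall>z. poly p z = snd (f (u, z)))"

definition critical_points ::
    "'v mapping_schema \<Rightarrow> ('v \<times> complex \<Rightarrow> 'v \<times> complex) \<Rightarrow> ('v \<times> complex) set" where
  "critical_points M f = {(u, z). u \<in> vertices M \<and> poly (pderiv (fibre_poly f u)) z = 0}"

definition local_degree :: "('v \<times> complex \<Rightarrow> 'v \<times> complex) \<Rightarrow> 'v \<times> complex \<Rightarrow> nat" where
  "local_degree f = (\<lambda>(u, z). order z (fibre_poly f u - [:poly (fibre_poly f u) z:]))"

definition postcritically_finite ::
    "'v mapping_schema \<Rightarrow> ('v \<times> complex \<Rightarrow> 'v \<times> complex) \<Rightarrow> bool" where
  "postcritically_finite M f \<longleftrightarrow>
     (\<forall>c\<in>critical_points M f. \<exists>m. \<exists>k>0. (f ^^ k) ((f ^^ m) c) = (f ^^ m) c)"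

text \<open>
  The subtraction does not truncate for \<open>f\<close> in \<^const>\<open>poly_maps\<close>: its components are
  nonconstant, so all local degrees are at least 1.
\<close>

definition postcritical_schema ::
    "('v \<times> complex \<Rightarrow> 'v \<times> complex) \<Rightarrow> ('v \<times> complex) set \<Rightarrow> ('v \<times> complex) mapping_schema" where
  "postcritical_schema f A = \<lparr>vertices = A, vmap = f, weight = (\<lambda>x. local_degree f x - 1)\<rparr>"

text \<open>The set \<open>W(u)\<close>; the canonical projection to the vertices of the base schema is \<^const>\<open>fst\<close>.\<close>

definition fibre :: "('v \<times> complex) mapping_schema \<Rightarrow> 'v \<Rightarrow> ('v \<times> complex) set" where
  "fibre S u = {x \<in> vertices S. fst x = u}"

definition return_period ::
    "'v mapping_schema \<Rightarrow> ('v \<times> complex) mapping_schema \<Rightarrow> 'v \<times> complex \<Rightarrow> real" where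
  "return_period M S x = real (exact_period (vmap S) x) / real (card (unique_cycle M))"

definition power_orbits :: "nat \<Rightarrow> nat \<Rightarrow> complex set set" where
  "power_orbits n k =
     {C \<in> periodic_orbits (\<lambda>z. z ^ n) UNIV. \<forall>z\<in>C. exact_period (\<lambda>z. z ^ n) z = k}"

definition num_power_orbits :: "nat \<Rightarrow> nat \<Rightarrow> nat" where
  "num_power_orbits n k = card (power_orbits n k)"

end

theory Submission
  imports Defs "HOL-Computational_Algebra.Fundamental_Theorem_Algebra"
begin

text \<open>
  Part (a) counts roots. The local degree of \<open>f\<close> at a point of \<open>{u} \<times> \<complex>\<close> over \<open>v\<close> is the
  multiplicity of that point as a root of \<open>p - c\<close>, where \<open>p\<close> is the polynomial of \<open>f\<close> on this
  copy of \<open>\<complex>\<close> and \<open>c\<close> is the complex coordinate of \<open>v\<close>. These multiplicities add up to at most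
  \<open>degree p\<close> (\<open>sum_degrees_over_preimage_le\<close>).

  For part (b), fix a vertex \<open>u\<close> of the cycle of the base schema. Every periodic orbit of \<open>f\<close>
  projects onto this cycle, so it meets \<open>{u} \<times> \<complex>\<close>, and there it is a periodic orbit of the
  first return map. That map is a polynomial \<open>P\<close> whose degree \<open>n\<close> is the product of the degrees
  along the cycle, and its periods are the return periods
  (\<open>first_return_poly\<close>, \<open>card_orbits_le_first_return\<close>). It remains to see that
  a complex polynomial \<open>P\<close> of degree \<open>n \<ge> 2\<close> has at most as many orbits of exact period \<open>k\<close> as
  \<open>z\<^sup>n\<close> (\<open>card_periodic_orbits_poly_le\<close>).

  The fixed points of the iterate \<open>P\<^sup>k\<close>, counted with multiplicity, are the \<open>n\<^sup>k\<close> roots of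
  \<open>P\<^sup>k(z) - z\<close>. This count has to be distributed over the exact periods. The multiplicity \<open>m\<^sub>k\<close> of
  a point \<open>z\<close> in \<open>P\<^sup>k(z) - z\<close> depends on \<open>k\<close> in a simple way: it is \<open>0\<close> unless \<open>k\<close> is
  a multiple of the period \<open>d\<close> of \<open>z\<close>. Among these multiples, it is \<open>1\<close> if the derivative of
  \<open>P\<^sup>k\<close> at \<open>z\<close> differs from 1. The remaining \<open>k\<close>, if any, are the multiples of the least one
  \<open>r\<close> among them, and there it is constant (\<open>order_iterate_multiplier_one\<close>). Hence \<open>m\<^sub>k\<close>
  is a sum over the divisors of \<open>k\<close> of nonnegative contributions: \<open>1\<close> at \<open>d\<close>, and \<open>m\<^sub>r - 1\<close> at \<open>r\<close> if it exists
  (\<open>order_eq_sum_dynatomic_order\<close>). Let \<open>D\<^sub>k\<close> be the total contribution of all points at \<open>k\<close>.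
  It is at least the number of points of exact period \<open>k\<close>, and the relations
  \<open>\<Sum>\<^bsub>j | k\<^esub> D\<^sub>j = n\<^sup>k\<close> determine it in terms of \<open>n\<close> and \<open>k\<close> alone. For \<open>z\<^sup>n\<close> the derivative is
  never 1 at a periodic point, so there \<open>D\<^sub>k\<close> is exactly the number of points of exact period
  \<open>k\<close>. Dividing by \<open>k\<close> turns points into orbits.
\<close>

section \<open>Least elements and divisor sums\<close>

definition least_positive :: "(nat \<Rightarrow> bool) \<Rightarrow> nat \<Rightarrow> bool" where
  "least_positive R j \<longleftrightarrow> 0 < j \<and> R j \<and> (\<forall>i. 0 < i \<longrightarrow> i < j \<longrightarrow> \<not> R i)"

lemma least_positive_unique: "least_positive R i \<Longrightarrow> least_positive R j \<Longrightarrow> i = j"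
  unfolding least_positive_def by (meson linorder_neqE_nat)

lemma least_positive_exists:
  assumes "R k" "0 < k"
  obtains d where "least_positive R d"
proof -
  have "least_positive R (LEAST j. 0 < j \<and> R j)"
    unfolding least_positive_def
    using LeastI[of "\<lambda>j. 0 < j \<and> R j" k] not_less_Least[of _ "\<lambda>j. 0 < j \<and> R j"] assms by blast
  then show ?thesis by (rule that)
qed

text \<open>
  Such a set of naturals is the trace of a subgroup of the integers. The lemma serves twice: for the
  exponents whose iterate fixes a point, and for those whose iterate moreover has derivative 1 there.
\<close>
lemma iff_least_positive_dvd:
  assumes add: "\<And>i j. R i \<Longrightarrow> R j \<Longrightarrow> R (i + j)"
    and cancel: "\<And>i j. R i \<Longrightarrow> R (i + j) \<Longrightarrow> R j"
    and d: "least_positive R d"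
  shows "R k \<longleftrightarrow> d dvd k"
proof (induction k rule: less_induct)
  case (less k)
  have Rd: "R d" and dpos: "0 < d" using d by (auto simp: least_positive_def)
  show ?case
  proof (cases "k < d")
    case True
    have "R 0" using cancel[of d 0] Rd by simp
    then show ?thesis
      using True d by (cases "k = 0") (auto simp: least_positive_def dest: dvd_imp_le)
  next
    case False
    then have k: "k = d + (k - d)" by simp
    have "R k \<longleftrightarrow> R (k - d)" using add[OF Rd, of "k - d"] cancel[OF Rd, of "k - d"] k by auto
    also have "\<dots> \<longleftrightarrow> d dvd (k - d)" using less.IH[of "k - d"] dpos False by simp
    also have "\<dots> \<longleftrightarrow> d dvd k" using False by (simp add: dvd_minus_self)
    finally show ?thesis .
  qed
qed

text \<open>
  If the predicate holds at \<open>k\<close>, then its least positive instance divides \<open>k\<close> and is the only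
  divisor that contributes; otherwise no divisor does.
\<close>
lemma sum_divisors_least_positive:
  fixes c :: "nat \<Rightarrow> nat"
  assumes add: "\<And>i j. R i \<Longrightarrow> R j \<Longrightarrow> R (i + j)"
    and cancel: "\<And>i j. R i \<Longrightarrow> R (i + j) \<Longrightarrow> R j"
    and const: "\<And>j. least_positive R j \<Longrightarrow> j dvd k \<Longrightarrow> c j = c k"
    and k: "0 < k"
  shows "(\<Sum>j | j dvd k. if least_positive R j then c j else 0) = (if R k then c k else 0)"
proof -
  have dvd_iff: "R k \<longleftrightarrow> j dvd k" if "least_positive R j" for j
    by (rule iff_least_positive_dvd[OF _ _ that]) (erule (1) add, erule (1) cancel)
  show ?thesis
  proof (cases "R k")
    case True
    obtain d where d: "least_positive R d" using least_positive_exists[of R k] True k by blast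
    have dk: "d dvd k" using dvd_iff[OF d] True by blast
    have "least_positive R j \<longleftrightarrow> j = d" for j using d least_positive_unique by blast
    then have "(\<Sum>j | j dvd k. if least_positive R j then c j else 0)
        = (\<Sum>j | j dvd k. if j = d then c j else 0)" by simp
    also have "\<dots> = c d" using k dk by (simp add: sum.delta)
    finally show ?thesis using const[OF d dk] True by simp
  next
    case False
    have "\<not> least_positive R j" if "j dvd k" for j
      using dvd_iff[of j] that False by blast
    then have "(\<Sum>j | j dvd k. if least_positive R j then c j else 0) = 0"
      by (intro sum.neutral) auto
    with False show ?thesis by simp
  qed
qed

text \<open>The uniqueness half of Moebius inversion, which avoids the inversion formula.\<close>
lemma divisor_sum_determines:
  fixes f g :: "nat \<Rightarrow> nat"
  assumes eq: "\<And>k. 0 < k \<Longrightarrow> (\<Sum>j | j dvd k. f j) = (\<Sum>j | j dvd k. g j)"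
    and "0 < k"
  shows "f k = g k"
  using \<open>0 < k\<close>
proof (induction k rule: less_induct)
  case (less k)
  have split: "(\<Sum>j | j dvd k. h j) = h k + (\<Sum>j\<in>{j. j dvd k} - {k}. h j)" for h :: "nat \<Rightarrow> nat"
    using less.prems by (intro sum.remove) auto
  have "(\<Sum>j\<in>{j. j dvd k} - {k}. f j) = (\<Sum>j\<in>{j. j dvd k} - {k}. g j)"
  proof (rule sum.cong)
    fix j assume "j \<in> {j. j dvd k} - {k}"
    then have "0 < j" "j < k" using less.prems by (auto dest: dvd_imp_le intro: Nat.gr0I)
    then show "f j = g j" using less.IH by blast
  qed simp
  then show ?case using eq[OF less.prems] split[of f] split[of g] by simp
qed

section \<open>Periods and periodic orbits\<close>

definition has_period :: "('a \<Rightarrow> 'a) \<Rightarrow> nat \<Rightarrow> 'a \<Rightarrow> bool" where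
  "has_period g k x \<longleftrightarrow> least_positive (\<lambda>i. (g ^^ i) x = x) k"

lemma funpow_fixed_add: "(g ^^ i) x = x \<Longrightarrow> (g ^^ j) x = x \<Longrightarrow> (g ^^ (i + j)) x = x"
  by (simp add: funpow_add)

lemma funpow_fixed_cancel: "(g ^^ i) x = x \<Longrightarrow> (g ^^ (i + j)) x = x \<Longrightarrow> (g ^^ j) x = x"
  by (metis add.commute comp_apply funpow_add)

lemma has_period_fixed_iff: "has_period g k x \<Longrightarrow> (g ^^ i) x = x \<longleftrightarrow> k dvd i"
  unfolding has_period_def
  by (rule iff_least_positive_dvd) (auto intro: funpow_fixed_add funpow_fixed_cancel)

lemma has_period_exact_period: "has_period g k x \<Longrightarrow> exact_period g x = k"
  unfolding has_period_def least_positive_def exact_period_def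
  by (intro Least_equality) (auto simp: not_less[symmetric])

lemma has_period_orbit:
  assumes "has_period g k x"
  shows "orbit g x = (\<lambda>i. (g ^^ i) x) ` {..<k}" and "inj_on (\<lambda>i. (g ^^ i) x) {..<k}"
    and "card (orbit g x) = k" and "x \<in> orbit g x" and "cyclic_on g (orbit g x)"
proof -
  have k: "0 < k" "(g ^^ k) x = x" using assms by (auto simp: has_period_def least_positive_def)
  show *: "orbit g x = (\<lambda>i. (g ^^ i) x) ` {..<k}"
    using orbit_altdef_bounded[OF k(2,1)] by auto
  show inj: "inj_on (\<lambda>i. (g ^^ i) x) {..<k}"
  proof (rule linorder_inj_onI)
    fix i j :: nat assume "i < j" and ij: "i \<in> {..<k}" "j \<in> {..<k}"
    show "(g ^^ i) x \<noteq> (g ^^ j) x"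
    proof
      assume "(g ^^ i) x = (g ^^ j) x"
      then have "(g ^^ (k - j + i)) x = (g ^^ (k - j + j)) x" by (simp only: funpow_add comp_apply)
      then have "(g ^^ (k - j + i)) x = x" using k ij by simp
      then have "k dvd (k - j + i)" using has_period_fixed_iff[OF assms] by blast
      then show False using \<open>i < j\<close> ij by (auto dest: dvd_imp_le)
    qed
  qed auto
  show "card (orbit g x) = k" unfolding * using card_image[OF inj] by simp
  show x: "x \<in> orbit g x" unfolding orbit_altdef using k by force
  then show "cyclic_on g (orbit g x)" by (auto simp: cyclic_on_def)
qed

lemma cyclic_on_has_period:
  assumes "cyclic_on g C" "x \<in> C"
  shows "has_period g (card C) x"
proof -
  have C: "C = orbit g x" using assms by (simp add: orbit_cyclic_eq3)
  then obtain n where "0 < n" "(g ^^ n) x = x" using assms(2) by (auto simp: orbit_altdef)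
  then obtain d where "has_period g d x"
    using least_positive_exists[of "\<lambda>i. (g ^^ i) x = x" n] by (auto simp: has_period_def)
  with has_period_orbit(3)[OF this] C show ?thesis by simp
qed

text \<open>
  All points of a periodic orbit share their exact period, namely the size of the orbit. This
  replaces the pointwise conditions on periods by a condition on cardinalities.
\<close>
lemma orbits_exact_period_eq:
  "{C \<in> periodic_orbits g B. \<forall>x\<in>C. exact_period g x = k} = {C \<in> periodic_orbits g B. card C = k}"
proof -
  have "(\<forall>x\<in>C. exact_period g x = k) \<longleftrightarrow> card C = k" if "cyclic_on g C" for C
    using cyclic_on_has_period[OF that, THEN has_period_exact_period] that
    by (auto simp: cyclic_on_def)
  then show ?thesis by (auto simp: periodic_orbits_def)
qed

lemma orbits_mult_period:
  assumes k: "0 < k" and fin: "finite {x. has_period g k x}"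
  shows "finite {C \<in> periodic_orbits g UNIV. card C = k}"
    and "k * card {C \<in> periodic_orbits g UNIV. card C = k} = card {x. has_period g k x}"
proof -
  let ?O = "{C \<in> periodic_orbits g UNIV. card C = k}"
  have un: "\<Union>?O = {x. has_period g k x}"
  proof (intro equalityI subsetI)
    fix x assume "x \<in> {x. has_period g k x}"
    then have "orbit g x \<in> ?O" "x \<in> orbit g x"
      using has_period_orbit[of g k x] by (auto simp: periodic_orbits_def)
    then show "x \<in> \<Union>?O" by blast
  qed (auto simp: periodic_orbits_def dest: cyclic_on_has_period)
  then have "?O \<subseteq> Pow {x. has_period g k x}" by blast
  then show fO: "finite ?O" using fin by (auto intro: finite_subset)
  show "k * card ?O = card {x. has_period g k x}"
    unfolding un[symmetric]
  proof (rule card_partition[OF fO])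
    show "finite (\<Union>?O)" unfolding un by (rule fin)
    fix C D assume "C \<in> ?O" "D \<in> ?O" "C \<noteq> D"
    then show "C \<inter> D = {}"
      using orbit_cyclic_eq3[of g C] orbit_cyclic_eq3[of g D] by (auto simp: periodic_orbits_def)
  qed auto
qed

section \<open>Iterating polynomials\<close>

definition iterate_poly :: "'a::comm_semiring_1 poly \<Rightarrow> nat \<Rightarrow> 'a poly" where
  "iterate_poly p k = (pcompose p ^^ k) [:0, 1:]"

lemma iterate_poly_0 [simp]: "iterate_poly p 0 = [:0, 1:]"
  and iterate_poly_Suc [simp]: "iterate_poly p (Suc k) = pcompose p (iterate_poly p k)"
  by (simp_all add: iterate_poly_def)

lemma poly_iterate_poly: "poly (iterate_poly p k) = poly p ^^ k"
  by (induction k) (auto simp: fun_eq_iff poly_pcompose)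

lemma degree_iterate_poly:
  fixes p :: "'a::idom poly"
  shows "degree (iterate_poly p k) = degree p ^ k"
  by (induction k) (simp_all add: degree_pcompose)

lemma iterate_poly_add:
  fixes p :: "'a::{idom,ring_char_0} poly"
  shows "iterate_poly p (i + j) = pcompose (iterate_poly p i) (iterate_poly p j)"
  by (subst poly_eq_poly_eq_iff[symmetric])
     (auto simp: fun_eq_iff poly_iterate_poly poly_pcompose funpow_add)

lemma iterate_poly_mult:
  fixes p :: "'a::{idom,ring_char_0} poly"
  shows "iterate_poly p (i * j) = iterate_poly (iterate_poly p i) j"
  by (subst poly_eq_poly_eq_iff[symmetric])
     (auto simp: fun_eq_iff poly_iterate_poly funpow_mult)

text \<open>
  At a fixed point of the inner iterate the chain rule multiplies the derivatives, so the exponents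
  with derivative 1 are closed under addition and cancellation.
\<close>
lemma multiplier_add:
  fixes p :: "'a::{idom,ring_char_0} poly"
  assumes "(poly p ^^ j) z = z"
  shows "poly (pderiv (iterate_poly p (i + j))) z
       = poly (pderiv (iterate_poly p i)) z * poly (pderiv (iterate_poly p j)) z"
  using assms by (simp add: iterate_poly_add pderiv_pcompose poly_pcompose poly_iterate_poly)

lemma multiplier_one_iterate:
  fixes r :: "'a::{idom,ring_char_0} poly"
  assumes "poly r z = z" "poly (pderiv r) z = 1"
  shows "(poly r ^^ j) z = z" and "poly (pderiv (iterate_poly r j)) z = 1"
proof -
  show *: "(poly r ^^ i) z = z" for i using assms by (induction i) auto
  show "poly (pderiv (iterate_poly r j)) z = 1"
    using assms
    by (induction j) (simp_all add: pderiv_pcompose poly_pcompose poly_iterate_poly * pderiv_pCons)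
qed

section \<open>Multiplicity of a fixed point of an iterate\<close>

lemma pcompose_power: "pcompose (p ^ n) q = pcompose p q ^ n" for p :: "'a::comm_semiring_1 poly"
  by (induction n) (simp_all add: pcompose_mult pcompose_1)

lemma order_eqI:
  fixes p :: "'a::idom poly"
  assumes "p = [:-z, 1:] ^ n * q" "poly q z \<noteq> 0"
  shows "order z p = n"
proof (rule order_unique_lemma)
  show "[:-z, 1:] ^ n dvd p" using assms by simp
  show "\<not> [:-z, 1:] ^ Suc n dvd p"
  proof
    assume "[:-z, 1:] ^ Suc n dvd p"
    then have "[:-z, 1:] ^ n * [:-z, 1:] dvd [:-z, 1:] ^ n * q" using assms by (simp add: mult.commute)
    then have "[:-z, 1:] dvd q" by (subst (asm) dvd_mult_cancel_left) auto
    then show False using assms by (simp add: poly_eq_0_iff_dvd)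
  qed
qed

text \<open>
  Near such a fixed point \<open>r(x) = x + c (x - z)\<^sup>a + \<dots>\<close> with \<open>c \<noteq> 0\<close>, and to this order each
  further application of \<open>r\<close> adds the same term: the \<open>j\<close>-th iterate is
  \<open>x + j c (x - z)\<^sup>a + \<dots>\<close>, where \<open>j c \<noteq> 0\<close> in characteristic 0. The proof makes this exact by
  telescoping the iterate minus the identity into the polynomials \<open>(r - id) \<circ> r\<^sup>i\<close>, each of
  which is \<open>(x - z)\<^sup>a\<close> times a polynomial with the same value at \<open>z\<close>.
\<close>
lemma order_iterate_multiplier_one:
  fixes r :: "'a::field_char_0 poly"
  assumes fixed: "poly r z = z" and mult: "poly (pderiv r) z = 1"
    and nontriv: "r \<noteq> [:0, 1:]" and j: "0 < j"
  shows "order z (iterate_poly r j - [:0, 1:]) = order z (r - [:0, 1:])"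
proof -
  define a where "a = order z (r - [:0, 1:])"
  have "r - [:0, 1:] \<noteq> 0" using nontriv by simp
  from order_decomp[OF this, of z] obtain g where
    g: "r - [:0, 1:] = [:-z, 1:] ^ a * g" and "\<not> [:-z, 1:] dvd g" unfolding a_def by blast
  then have gz: "poly g z \<noteq> 0" by (simp add: poly_eq_0_iff_dvd)
  \<comment> \<open>Since \<open>z\<close> is fixed with derivative 1, each iterate is \<open>z + (x - z) h(x)\<close> with \<open>h(z) = 1\<close>.\<close>
  have "\<exists>h. iterate_poly r i - [:z:] = [:-z, 1:] * h \<and> poly h z = 1" for i
  proof -
    have "poly (iterate_poly r i - [:z:]) z = 0"
      using multiplier_one_iterate(1)[OF fixed mult] by (simp add: poly_iterate_poly)
    then have "[:-z, 1:] dvd iterate_poly r i - [:z:]" by (simp only: poly_eq_0_iff_dvd)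
    then obtain h where h: "iterate_poly r i - [:z:] = [:-z, 1:] * h" ..
    have "pderiv (iterate_poly r i) = pderiv (iterate_poly r i - [:z:])"
      by (simp add: pderiv_diff pderiv_pCons)
    also have "\<dots> = [:-z, 1:] * pderiv h + h * pderiv [:-z, 1:]"
      unfolding h by (rule pderiv_mult)
    finally have "poly h z = 1"
      using multiplier_one_iterate(2)[OF fixed mult, of i] by (simp add: pderiv_pCons)
    with h show ?thesis by blast
  qed
  then obtain h where h: "\<And>i. iterate_poly r i - [:z:] = [:-z, 1:] * h i" "\<And>i. poly (h i) z = 1"
    by metis
  define G where "G i = h i ^ a * pcompose g (iterate_poly r i)" for i
  have step: "iterate_poly r (Suc i) - iterate_poly r i = [:-z, 1:] ^ a * G i" for i
  proof -
    have "iterate_poly r (Suc i) - iterate_poly r i = pcompose (r - [:0, 1:]) (iterate_poly r i)"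
      by (simp add: pcompose_diff pcompose_pCons)
    also have "\<dots> = pcompose [:-z, 1:] (iterate_poly r i) ^ a * pcompose g (iterate_poly r i)"
      unfolding g by (simp add: pcompose_mult pcompose_power)
    also have "pcompose [:-z, 1:] (iterate_poly r i) = [:-z, 1:] * h i"
      unfolding h(1)[symmetric] by (simp add: pcompose_pCons)
    finally show ?thesis by (simp only: G_def power_mult_distrib mult.assoc)
  qed
  have "iterate_poly r j - [:0, 1:] = [:-z, 1:] ^ a * (\<Sum>i<j. G i)"
  proof -
    have "(\<Sum>i<j. iterate_poly r (Suc i) - iterate_poly r i) = iterate_poly r j - iterate_poly r 0"
      by (rule sum_lessThan_telescope)
    then show ?thesis by (simp only: step sum_distrib_left[symmetric] iterate_poly_0)
  qed
  moreover have "poly (\<Sum>i<j. G i) z = of_nat j * poly g z"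
    using multiplier_one_iterate(1)[OF fixed mult]
    by (simp add: G_def poly_sum poly_pcompose poly_iterate_poly h(2))
  then have "poly (\<Sum>i<j. G i) z \<noteq> 0" using gz j by simp
  ultimately show ?thesis unfolding a_def[symmetric] by (rule order_eqI)
qed

lemma order_multiplier_ne_one:
  fixes r :: "'a::{idom,semiring_char_0} poly"
  assumes "poly r z = z" "poly (pderiv r) z \<noteq> 1"
  shows "order z (r - [:0, 1:]) = 1"
proof -
  have "poly (pderiv (r - [:0, 1:])) z \<noteq> 0"
    using assms by (simp add: pderiv_diff pderiv_pCons)
  moreover from this have "r - [:0, 1:] \<noteq> 0" by auto
  ultimately show ?thesis using assms(1) by (simp add: order_pderiv order_0I)
qed

text \<open>
  For \<open>p\<close> of degree at least 2 and \<open>k > 0\<close>, the order of vanishing at \<open>z\<close> of the \<open>k\<close>-th dynatomic polynomial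
  \<open>\<Prod>\<^bsub>j | k\<^esub> (p\<^sup>j(x) - x)\<^bsup>\<mu>(k/j)\<^esup>\<close>. It is written in closed form so that it is visibly nonnegative.
  The first summand comes from the exact period of \<open>z\<close>; the second comes from the least iterate
  fixing \<open>z\<close> with derivative 1, where the multiplicity of the fixed point first exceeds 1.
\<close>
definition dynatomic_order :: "complex poly \<Rightarrow> nat \<Rightarrow> complex \<Rightarrow> nat" where
  "dynatomic_order p k z =
     (if has_period (poly p) k z then 1 else 0) +
     (if least_positive
          (\<lambda>i. (poly p ^^ i) z = z \<and> poly (pderiv (iterate_poly p i)) z = 1) k
      then order z (iterate_poly p k - [:0, 1:]) - 1 else 0)"

lemma iterate_poly_minus_id_degree:
  fixes p :: "complex poly"
  assumes "2 \<le> degree p" "0 < k"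
  shows "degree (iterate_poly p k - [:0, 1:]) = degree p ^ k" "iterate_poly p k \<noteq> [:0, 1:]"
proof -
  have "(1::nat) < degree p ^ k" using assms by (intro one_less_power) auto
  then have d: "1 < degree (iterate_poly p k)" by (simp add: degree_iterate_poly)
  then show "degree (iterate_poly p k - [:0, 1:]) = degree p ^ k"
    using degree_add_eq_left[of "- [:0, 1:]" "iterate_poly p k"] by (simp del: minus_pCons add: degree_iterate_poly)
  show "iterate_poly p k \<noteq> [:0, 1:]" using d by auto
qed

text \<open>
  The two summands add up over the divisors of \<open>k\<close> to 1 if \<open>z\<close> is fixed by the \<open>k\<close>-th iterate,
  and to the multiplicity minus 1 if the derivative is moreover 1; a fixed point with
  a different derivative is simple.
\<close>
lemma order_eq_sum_dynatomic_order:
  fixes p :: "complex poly"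
  assumes p: "2 \<le> degree p" and k: "0 < k"
  shows "(if (poly p ^^ k) z = z then order z (iterate_poly p k - [:0, 1:]) else 0)
       = (\<Sum>j | j dvd k. dynatomic_order p j z)"
proof -
  define F where "F i \<longleftrightarrow> (poly p ^^ i) z = z" for i
  define U where "U i \<longleftrightarrow> (poly p ^^ i) z = z \<and> poly (pderiv (iterate_poly p i)) z = 1" for i
  define m where "m i = order z (iterate_poly p i - [:0, 1:])" for i
  have Fsum: "(\<Sum>j | j dvd k. if least_positive F j then 1 else 0) = (if F k then 1 else 0::nat)"
    using k by (intro sum_divisors_least_positive[where c = "\<lambda>_. 1"])
      (auto simp: F_def intro: funpow_fixed_add funpow_fixed_cancel)
  have Uadd: "U (i + j)" if "U i" "U j" for i j
    using that multiplier_add[of j p z i] by (simp add: U_def funpow_fixed_add)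
  have Ucancel: "U j" if "U i" "U (i + j)" for i j
  proof -
    have "(poly p ^^ j) z = z" using that funpow_fixed_cancel unfolding U_def by fast
    then show ?thesis using that multiplier_add[of j p z i] by (simp add: U_def)
  qed
  \<comment> \<open>The \<open>k\<close>-th iterate is an iterate of the \<open>j\<close>-th, so passing to it keeps the multiplicity.\<close>
  have "m j = m k" if "least_positive U j" "j dvd k" for j
  proof -
    from \<open>j dvd k\<close> obtain i where i: "k = j * i" ..
    have "0 < j" "0 < i" using k i by (auto intro: Nat.gr0I)
    have "poly (iterate_poly p j) z = z" "poly (pderiv (iterate_poly p j)) z = 1"
      using that by (auto simp: least_positive_def U_def poly_iterate_poly)
    from order_iterate_multiplier_one[OF this iterate_poly_minus_id_degree(2)[OF p \<open>0 < j\<close>] \<open>0 < i\<close>]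
    show ?thesis by (simp add: m_def i iterate_poly_mult)
  qed
  then have Usum: "(\<Sum>j | j dvd k. if least_positive U j then m j - 1 else 0) = (if U k then m k - 1 else 0)"
    using k by (intro sum_divisors_least_positive[where c = "\<lambda>j. m j - 1"])
      (auto intro: Uadd Ucancel)
  have "(\<Sum>j | j dvd k. dynatomic_order p j z)
      = (if F k then 1 else 0) + (if U k then m k - 1 else 0)"
    unfolding Fsum[symmetric] Usum[symmetric] sum.distrib[symmetric]
    unfolding dynatomic_order_def has_period_def F_def[abs_def] U_def[abs_def] m_def ..
  also have "\<dots> = (if F k then m k else 0)"
  proof (cases "U k")
    case True
    have "iterate_poly p k - [:0, 1:] \<noteq> 0" using iterate_poly_minus_id_degree(2)[OF p k] by simp
    then have "m k > 0"
      unfolding m_def using True by (simp add: order_gt_0_iff U_def poly_iterate_poly)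
    then show ?thesis using True by (simp add: U_def F_def)
  next
    case False
    then show ?thesis
      using order_multiplier_ne_one[of "iterate_poly p k" z]
      by (auto simp: U_def F_def m_def poly_iterate_poly)
  qed
  finally show ?thesis by (simp add: F_def m_def)
qed

section \<open>Counting periodic points of a polynomial\<close>

text \<open>
  For \<open>p\<close> of degree at least 2 and \<open>k > 0\<close>, the number of roots of the \<open>k\<close>-th dynatomic polynomial
  counted with multiplicity, hence its degree.
  The sum over the fixed points of the \<open>k\<close>-th iterate misses no root, as every root is one of them.
\<close>
definition dynatomic_degree :: "complex poly \<Rightarrow> nat \<Rightarrow> nat" where
  "dynatomic_degree p k = (\<Sum>z | (poly p ^^ k) z = z. dynatomic_order p k z)"

lemma periodic_points_as_roots:
  "{z. (poly p ^^ k) z = z} = {z. poly (iterate_poly p k - [:0, 1:]) z = 0}"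
  for p :: "complex poly"
  by (simp add: poly_iterate_poly)

lemma finite_periodic_points:
  fixes p :: "complex poly"
  assumes "2 \<le> degree p" "0 < k"
  shows "finite {z. (poly p ^^ k) z = z}" and "finite {z. has_period (poly p) k z}"
proof -
  show *: "finite {z. (poly p ^^ k) z = z}"
    unfolding periodic_points_as_roots
    using iterate_poly_minus_id_degree(2)[OF assms] by (intro poly_roots_finite) simp
  show "finite {z. has_period (poly p) k z}"
    by (rule finite_subset[OF _ *]) (auto simp: has_period_def least_positive_def)
qed

text \<open>Count the fixed points of the \<open>k\<close>-th iterate with multiplicity and exchange the two sums.\<close>
lemma sum_dynatomic_degree:
  fixes p :: "complex poly"
  assumes p: "2 \<le> degree p" and k: "0 < k"
  shows "(\<Sum>j | j dvd k. dynatomic_degree p j) = degree p ^ k"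
proof -
  let ?q = "iterate_poly p k - [:0, 1:]" and ?F = "\<lambda>k. {z. (poly p ^^ k) z = z}"
  note fin = finite_periodic_points(1)[OF p]
  have "?q \<noteq> 0" using iterate_poly_minus_id_degree(2)[OF p k] by simp
  have "degree p ^ k = size (proots ?q)"
    by (simp add: size_proots_complex iterate_poly_minus_id_degree(1)[OF p k])
  also have "\<dots> = (\<Sum>z\<in>?F k. order z ?q)"
    using \<open>?q \<noteq> 0\<close> by (simp add: size_multiset_overloaded_eq periodic_points_as_roots)
  also have "\<dots> = (\<Sum>z\<in>?F k. \<Sum>j | j dvd k. dynatomic_order p j z)"
    by (intro sum.cong) (auto simp: order_eq_sum_dynatomic_order[OF p k, symmetric])
  also have "\<dots> = (\<Sum>j | j dvd k. \<Sum>z\<in>?F k. dynatomic_order p j z)"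
    by (rule sum.swap)
  also have "\<dots> = (\<Sum>j | j dvd k. dynatomic_degree p j)"
  proof (rule sum.cong)
    fix j assume "j \<in> {j. j dvd k}"
    then obtain i where i: "k = j * i" by auto
    have "?F j \<subseteq> ?F k"
    proof
      fix z assume "z \<in> ?F j"
      then have "((poly p ^^ j) ^^ i) z = z" by (induction i) auto
      then show "z \<in> ?F k" by (simp add: i funpow_mult)
    qed
    then show "(\<Sum>z\<in>?F k. dynatomic_order p j z) = dynatomic_degree p j"
      unfolding dynatomic_degree_def
      by (intro sum.mono_neutral_right fin[OF k])
         (auto simp: dynatomic_order_def has_period_def least_positive_def)
  qed simp
  finally show ?thesis ..
qed

lemma card_has_period_le_dynatomic_degree:
  fixes p :: "complex poly"
  assumes "2 \<le> degree p" "0 < k"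
  shows "card {z. has_period (poly p) k z} \<le> dynatomic_degree p k"
proof -
  have "card {z. has_period (poly p) k z} = (\<Sum>z | has_period (poly p) k z. 1)" by simp
  also have "\<dots> \<le> (\<Sum>z | has_period (poly p) k z. dynatomic_order p k z)"
    by (intro sum_mono) (simp add: dynatomic_order_def)
  also have "\<dots> \<le> dynatomic_degree p k"
    unfolding dynatomic_degree_def using finite_periodic_points[OF assms]
    by (intro sum_mono2) (auto simp: has_period_def least_positive_def)
  finally show ?thesis .
qed

lemma iterate_poly_monom: "iterate_poly (monom 1 n) k = monom (1::complex) (n ^ k)"
  by (subst poly_eq_poly_eq_iff[symmetric], rule ext, unfold poly_iterate_poly)
     (induction k, auto simp: poly_monom power_mult[symmetric] mult.commute)

text \<open>
  For \<open>z\<^sup>n\<close> the bound on the number of periodic points is attained: a fixed point of \<open>z\<^bsup>n^k\<^esup>\<close> is 0,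
  with derivative 0, or a root of unity, with derivative \<open>n\<^sup>k \<noteq> 1\<close>.
\<close>
lemma card_has_period_power:
  assumes n: "2 \<le> n" and k: "0 < k"
  shows "card {z::complex. has_period (\<lambda>z. z ^ n) k z} = dynatomic_degree (monom 1 n) k"
proof -
  let ?p = "monom 1 n :: complex poly"
  have pw: "poly ?p = (\<lambda>z. z ^ n)" by (simp add: fun_eq_iff poly_monom)
  have deg: "2 \<le> degree ?p" using n by (simp add: degree_monom_eq)
  have no_multiplier_one: "poly (pderiv (iterate_poly ?p k)) z \<noteq> 1" if "(poly ?p ^^ k) z = z" for z
  proof
    have nk: "1 < n ^ k" using n k by (intro one_less_power) auto
    assume "poly (pderiv (iterate_poly ?p k)) z = 1"
    then have 1: "of_nat (n ^ k) * z ^ (n ^ k - 1) = 1"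
      by (simp add: iterate_poly_monom pderiv_monom poly_monom)
    have "z ^ (n ^ k) = z"
      using that by (simp add: poly_iterate_poly[symmetric] iterate_poly_monom poly_monom)
    moreover have "z \<noteq> 0" using 1 nk by (auto simp: power_0_left split: if_splits)
    moreover have "z ^ (n ^ k) = z * z ^ (n ^ k - 1)"
      using power_minus_mult[of "n ^ k" z] nk by (simp only: mult.commute)
    ultimately have "z ^ (n ^ k - 1) = 1" by simp
    with 1 have "of_nat (n ^ k) = (of_nat 1 :: complex)" by simp
    then show False using nk by (simp only: of_nat_eq_iff)
  qed
  have "dynatomic_degree ?p k = (\<Sum>z | (poly ?p ^^ k) z = z. if has_period (poly ?p) k z then 1 else 0)"
    unfolding dynatomic_degree_def
    by (intro sum.cong) (use no_multiplier_one in \<open>auto simp: dynatomic_order_def least_positive_def\<close>)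
  also have "\<dots> = (\<Sum>z | has_period (poly ?p) k z. 1)"
    using finite_periodic_points[OF deg k]
    by (intro sum.mono_neutral_cong_right) (auto simp: has_period_def least_positive_def)
  finally show ?thesis by (simp add: pw)
qed

text \<open>
  The dynatomic degrees of \<open>p\<close> and of \<open>z\<^sup>n\<close> satisfy the same divisor sum relations, so they agree;
  this degree bounds the number of periodic points of \<open>p\<close> and equals the number for \<open>z\<^sup>n\<close>.
\<close>
theorem card_periodic_orbits_poly_le:
  fixes p :: "complex poly"
  assumes p: "2 \<le> degree p" and k: "0 < k"
  shows "card {C \<in> periodic_orbits (poly p) UNIV. card C = k} \<le> num_power_orbits (degree p) k"
proof -
  let ?q = "monom 1 (degree p) :: complex poly"
  have pw: "poly ?q = (\<lambda>z. z ^ degree p)" by (simp add: fun_eq_iff poly_monom)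
  have q: "2 \<le> degree ?q" using p by (simp add: degree_monom_eq)
  have "dynatomic_degree p k = dynatomic_degree ?q k"
    by (rule divisor_sum_determines[OF _ k])
       (simp add: sum_dynatomic_degree[OF p] sum_dynatomic_degree[OF q] degree_monom_eq)
  then have "card {z. has_period (poly p) k z} \<le> card {z::complex. has_period (\<lambda>z. z ^ degree p) k z}"
    using card_has_period_le_dynatomic_degree[OF p k] card_has_period_power[OF p k] by simp
  then have "k * card {C \<in> periodic_orbits (poly p) UNIV. card C = k}
           \<le> k * card {C \<in> periodic_orbits (\<lambda>z::complex. z ^ degree p) UNIV. card C = k}"
    using orbits_mult_period(2)[OF k finite_periodic_points(2)[OF p k]]
      orbits_mult_period(2)[OF k finite_periodic_points(2)[OF q k]] by (simp add: pw)
  then show ?thesis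
    using k by (simp add: num_power_orbits_def power_orbits_def orbits_exact_period_eq)
qed

section \<open>The cycle of a connected schema\<close>

text \<open>
  By finiteness some forward orbit is eventually periodic, which gives a cycle. Whether a vertex
  eventually enters a given cycle does not change along an arc in either direction, so by
  connectedness every vertex enters it; a second cycle would then meet the first.
\<close>
lemma ex1_periodic_orbit:
  assumes M: "mapping_schema M" and conn: "connected_schema M"
  shows "\<exists>!C. C \<in> periodic_orbits (vmap M) (vertices M)"
proof -
  let ?F = "vmap M" and ?V = "vertices M"
  have fin: "finite ?V" and maps: "\<And>x. x \<in> ?V \<Longrightarrow> ?F x \<in> ?V"
    using M by (auto simp: mapping_schema_def)
  have iter: "(?F ^^ i) x \<in> ?V" if "x \<in> ?V" for i x
    using that by (induction i) (auto intro: maps)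
  have "?V \<noteq> {}" and
    reach: "\<And>u v. u \<in> ?V \<Longrightarrow> v \<in> ?V \<Longrightarrow> u \<rightarrow>\<^sup>*\<^bsub>with_proj (mk_symmetric (schema_graph M))\<^esub> v"
    using conn
    by (auto simp: connected_schema_def Digraph_Component.connected_def strongly_connected_def
        schema_graph_def)
  then obtain x where x: "x \<in> ?V" by blast
  have "\<not> inj (\<lambda>i. (?F ^^ i) x)"
    using fin iter[OF x] finite_subset[of "range (\<lambda>i. (?F ^^ i) x)" ?V]
    by (auto dest: finite_imageD)
  then obtain i j where "i < j" "(?F ^^ i) x = (?F ^^ j) x"
    by (auto simp: inj_on_def) (metis linorder_neqE_nat)
  moreover define y where "y = (?F ^^ i) x"
  moreover have "(?F ^^ (j - i)) ((?F ^^ i) x) = (?F ^^ (j - i + i)) x"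
    by (simp only: funpow_add comp_apply)
  ultimately have "(?F ^^ (j - i)) y = y" "0 < j - i" by simp_all
  then have "y \<in> orbit ?F y"
    unfolding orbit_altdef by (intro CollectI exI[of _ "j - i"]) simp
  moreover have "y \<in> ?V" using iter[OF x] by (simp add: y_def)
  ultimately have C: "orbit ?F y \<in> periodic_orbits ?F ?V"
    using iter by (auto simp: periodic_orbits_def cyclic_on_def orbit_altdef)
  moreover have "C = D" if C: "C \<in> periodic_orbits ?F ?V" and D: "D \<in> periodic_orbits ?F ?V" for C D
  proof -
    have cyc: "cyclic_on ?F C" "cyclic_on ?F D" using C D by (auto simp: periodic_orbits_def)
    obtain c d where cd: "c \<in> C" "d \<in> D" "c \<in> ?V" "d \<in> ?V"
      using C D unfolding periodic_orbits_def cyclic_on_def by blast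
    define Q where "Q v \<longleftrightarrow> (\<exists>n. (?F ^^ n) v \<in> C)" for v
    have Q_step: "Q (?F v) \<longleftrightarrow> Q v" for v
    proof
      assume "Q (?F v)"
      then obtain n where "(?F ^^ Suc n) v \<in> C" by (auto simp: Q_def funpow_swap1)
      then show "Q v" unfolding Q_def by blast
    next
      assume "Q v"
      then obtain n where "(?F ^^ n) v \<in> C" by (auto simp: Q_def)
      then have "?F ((?F ^^ n) v) \<in> C" using cyc(1) cyclic_on_inI by fast
      then show "Q (?F v)" unfolding Q_def funpow_swap1 by blast
    qed
    have "Q d"
      using reach[OF cd(3,4)] unfolding reachable_def
    proof (induction rule: rtrancl_on_induct)
      case base
      have "(?F ^^ 0) c \<in> C" using cd by simp
      then show ?case unfolding Q_def by blast
    next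
      case (step v w)
      then have "w = ?F v \<or> v = ?F w"
        by (auto simp: parcs_mk_symmetric schema_graph_def)
      then show ?case using step Q_step by metis
    qed
    then obtain n where "(?F ^^ n) d \<in> C" by (auto simp: Q_def)
    moreover have "(?F ^^ n) d \<in> D" using cyc(2) cd by (simp add: cyclic_on_funpow_in)
    ultimately show ?thesis using cyc orbit_cyclic_eq3 by metis
  qed
  ultimately show ?thesis by blast
qed

lemma unique_cycle:
  assumes "mapping_schema M" "connected_schema M"
  shows "unique_cycle M \<in> periodic_orbits (vmap M) (vertices M)"
    and "C \<in> periodic_orbits (vmap M) (vertices M) \<Longrightarrow> C = unique_cycle M"
  using theI'[OF ex1_periodic_orbit[OF assms]] ex1_periodic_orbit[OF assms]
  unfolding unique_cycle_def by blast+

section \<open>Local degrees\<close>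

lemma poly_maps_fibre_poly:
  assumes "f \<in> poly_maps M" "u \<in> vertices M"
  shows "f (u, z) = (vmap M u, poly (fibre_poly f u) z)" and "degree (fibre_poly f u) = degree_at M u"
proof -
  obtain p where p: "monic_centered (degree_at M u) p" "\<And>z. f (u, z) = (vmap M u, poly p z)"
    using assms by (auto simp: poly_maps_def)
  have "fibre_poly f u = p"
    unfolding fibre_poly_def p(2) by (rule the_equality) (auto simp: poly_eq_poly_eq_iff[symmetric])
  with p show "f (u, z) = (vmap M u, poly (fibre_poly f u) z)"
    and "degree (fibre_poly f u) = degree_at M u"
    by (auto simp: monic_centered_def)
qed

text \<open>
  Over \<open>v\<close> the degrees are the orders of distinct roots of \<open>fibre_poly f u - [:snd v:]\<close>. This
  polynomial has the degree of \<open>u\<close>, because \<open>fibre_poly f u\<close> is not constant.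
\<close>
lemma sum_degrees_over_preimage_le:
  assumes f: "f \<in> poly_maps M" and u: "u \<in> vertices M"
  shows "(\<Sum>x\<in>{x \<in> fibre (postcritical_schema f A) u. f x = v}. degree_at (postcritical_schema f A) x)
       \<le> degree_at M u"
proof -
  let ?S = "postcritical_schema f A" and ?p = "fibre_poly f u"
  let ?X = "{x \<in> fibre ?S u. f x = v}" and ?q = "fibre_poly f u - [:snd v:]"
  have deg: "degree ?q = degree_at M u"
    using poly_maps_fibre_poly(2)[OF f u] degree_add_eq_left[of "- [:snd v:]" ?p]
    by (simp del: minus_pCons add: degree_at_def)
  then have q: "?q \<noteq> 0" by (auto simp: degree_at_def)
  have X: "x = (u, snd x) \<and> poly ?q (snd x) = 0 \<and> degree_at ?S x = order (snd x) ?q"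
    if "x \<in> ?X" for x
  proof -
    obtain z where x: "x = (u, z)" using \<open>x \<in> ?X\<close> by (cases x) (auto simp: fibre_def)
    have "poly ?p z = snd v" using \<open>x \<in> ?X\<close> by (auto simp: x poly_maps_fibre_poly(1)[OF f u])
    moreover from this have "order z ?q > 0" using q by (simp add: order_gt_0_iff)
    ultimately show ?thesis
      by (simp add: x degree_at_def postcritical_schema_def local_degree_def)
  qed
  have "inj_on snd ?X" using X by (metis (no_types, lifting) inj_onI)
  then have "(\<Sum>x\<in>?X. degree_at ?S x) = (\<Sum>z\<in>snd ` ?X. order z ?q)"
    using X by (simp add: sum.reindex)
  also have "\<dots> \<le> (\<Sum>z | poly ?q z = 0. order z ?q)"
    by (intro sum_mono2 poly_roots_finite[OF q]) (use X in blast)+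
  also have "\<dots> \<le> degree_at M u" using sum_order_le_degree[OF q] deg by simp
  finally show ?thesis .
qed

section \<open>The first return polynomial\<close>

lemma iterate_on_fibre:
  assumes M: "mapping_schema M" and f: "f \<in> poly_maps M" and u: "u \<in> vertices M"
  shows "\<exists>p. degree p = (\<Prod>j<i. degree_at M ((vmap M ^^ j) u)) \<and>
             (\<forall>z. (f ^^ i) (u, z) = ((vmap M ^^ i) u, poly p z))"
proof (induction i)
  case 0
  show ?case by (rule exI[of _ "[:0, 1:]"]) simp
next
  case (Suc i)
  then obtain p where p: "degree p = (\<Prod>j<i. degree_at M ((vmap M ^^ j) u))"
    "\<And>z. (f ^^ i) (u, z) = ((vmap M ^^ i) u, poly p z)" by blast
  have "(vmap M ^^ i) u \<in> vertices M"
    using u M by (induction i) (auto simp: mapping_schema_def)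
  from poly_maps_fibre_poly[OF f this] p show ?case
    by (intro exI[of _ "pcompose (fibre_poly f ((vmap M ^^ i) u)) p"])
       (simp add: degree_pcompose poly_pcompose mult.commute)
qed

lemma first_return_poly:
  assumes M: "mapping_schema M" "connected_schema M" and f: "f \<in> poly_maps M"
    and u: "u \<in> unique_cycle M"
  obtains p where "degree p = cycle_degree M"
    and "\<And>j z. (f ^^ (card (unique_cycle M) * j)) (u, z) = (u, (poly p ^^ j) z)"
proof -
  let ?l = "card (unique_cycle M)"
  have cyc: "cyclic_on (vmap M) (unique_cycle M)" and V: "u \<in> vertices M"
    using unique_cycle(1)[OF M] u by (auto simp: periodic_orbits_def)
  have per: "has_period (vmap M) ?l u" by (rule cyclic_on_has_period[OF cyc u])
  obtain p where p: "degree p = (\<Prod>j<?l. degree_at M ((vmap M ^^ j) u))"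
    "\<And>z. (f ^^ ?l) (u, z) = ((vmap M ^^ ?l) u, poly p z)"
    using iterate_on_fibre[OF M(1) f V] by blast
  have "cycle_degree M = prod (degree_at M) ((\<lambda>j. (vmap M ^^ j) u) ` {..<?l})"
    using has_period_orbit(1)[OF per] orbit_cyclic_eq3[OF cyc u] by (simp add: cycle_degree_def)
  also have "\<dots> = degree p"
    unfolding p(1) by (simp add: prod.reindex[OF has_period_orbit(2)[OF per]])
  finally have "degree p = cycle_degree M" ..
  moreover have "(f ^^ ?l) (u, z) = (u, poly p z)" for z
    using p(2) has_period_fixed_iff[OF per, of ?l] by simp
  then have "((f ^^ ?l) ^^ j) (u, z) = (u, (poly p ^^ j) z)" for j z
    by (induction j) auto
  ultimately show ?thesis using that by (simp add: funpow_mult)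
qed

lemma two_le_cycle_degree:
  assumes "mapping_schema M" "connected_schema M" "\<exists>u\<in>unique_cycle M. critical_vertex M u"
  shows "2 \<le> cycle_degree M"
proof -
  obtain u where u: "u \<in> unique_cycle M" "critical_vertex M u" using assms by blast
  have fin: "finite (unique_cycle M)"
    using unique_cycle(1)[OF assms(1,2)] by (auto simp: periodic_orbits_def intro: finite_cyclic_on)
  have "2 \<le> degree_at M u" using u by (simp add: critical_vertex_def degree_at_def)
  moreover have "degree_at M u dvd cycle_degree M"
    unfolding cycle_degree_def using fin u by (intro dvd_prodI)
  moreover have "0 < cycle_degree M"
    unfolding cycle_degree_def by (intro prod_pos) (simp add: degree_at_def)
  ultimately show ?thesis using dvd_imp_le[of "degree_at M u" "cycle_degree M"] by linarith
qed

text \<open>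
  An orbit of \<open>f\<close> is sent to the first-return orbit of one of its points over \<open>u\<close>. The image,
  placed over \<open>u\<close>, lies in the original orbit, and distinct orbits are disjoint, so this is
  injective. A point over \<open>u\<close> can return to itself only at multiples of the length of the base
  cycle, so the period is divided by that length.
\<close>
lemma card_orbits_le_first_return:
  assumes M: "mapping_schema M" "connected_schema M" and f: "f \<in> poly_maps M"
    and A: "A \<subseteq> vertices M \<times> UNIV"
    and u: "u \<in> unique_cycle M"
    and p: "\<And>j z. (f ^^ (card (unique_cycle M) * j)) (u, z) = (u, (poly p ^^ j) z)"
    and fin: "finite {D \<in> periodic_orbits (poly p) UNIV. card D = k}"
  shows "card {C \<in> periodic_orbits f A. card C = card (unique_cycle M) * k}
       \<le> card {D \<in> periodic_orbits (poly p) UNIV. card D = k}"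
proof -
  let ?l = "card (unique_cycle M)"
  let ?O = "{C \<in> periodic_orbits f A. card C = ?l * k}"
  have cyc: "cyclic_on (vmap M) (unique_cycle M)"
    using unique_cycle(1)[OF M] by (auto simp: periodic_orbits_def)
  have per: "has_period (vmap M) ?l u" by (rule cyclic_on_has_period[OF cyc u])
  have l: "0 < ?l" using per by (simp add: has_period_def least_positive_def)
  \<comment> \<open>The projection of an orbit is a cycle of the base schema, hence contains \<open>u\<close>.\<close>
  have "\<exists>z. (u, z) \<in> C" if "C \<in> ?O" for C
  proof -
    have C: "cyclic_on f C" "C \<subseteq> vertices M \<times> UNIV" using that A by (auto simp: periodic_orbits_def)
    have "vmap M (fst x) = fst (f x)" if "x \<in> C" for x
      using that C(2) poly_maps_fibre_poly(1)[OF f, of "fst x" "snd x"] by auto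
    then have "cyclic_on (vmap M) (fst ` C)" by (rule cyclic_on_image[OF C(1)])
    moreover have "fst ` C \<subseteq> vertices M" using C(2) by auto
    ultimately have "fst ` C = unique_cycle M"
      by (intro unique_cycle(2)[OF M]) (simp add: periodic_orbits_def)
    then show ?thesis using u by force
  qed
  then obtain c where c: "\<And>C. C \<in> ?O \<Longrightarrow> (u, c C) \<in> C" by metis
  have per_c: "has_period (poly p) k (c C)" if C: "C \<in> ?O" for C
  proof -
    have perC: "has_period f (?l * k) (u, c C)"
      using cyclic_on_has_period[of f C "(u, c C)"] C c[OF C] by (auto simp: periodic_orbits_def)
    have fix_iff: "(poly p ^^ i) (c C) = c C \<longleftrightarrow> k dvd i" for i
      using has_period_fixed_iff[OF perC, of "?l * i"] p[of i "c C"] l by simp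
    moreover have "0 < k" using perC by (auto simp: has_period_def least_positive_def)
    ultimately show ?thesis
      by (auto simp: has_period_def least_positive_def dest: dvd_imp_le)
  qed
  have orb: "{u} \<times> orbit (poly p) (c C) \<subseteq> C" if C: "C \<in> ?O" for C
  proof -
    have "(u, (poly p ^^ j) (c C)) \<in> C" for j
      unfolding p[symmetric] using C c[OF C]
      by (intro cyclic_on_funpow_in) (auto simp: periodic_orbits_def)
    then show ?thesis by (auto simp: orbit_altdef)
  qed
  show ?thesis
  proof (rule card_inj_on_le[where f = "\<lambda>C. orbit (poly p) (c C)"])
    show "inj_on (\<lambda>C. orbit (poly p) (c C)) ?O"
    proof (rule inj_onI)
      fix C D assume CD: "C \<in> ?O" "D \<in> ?O" "orbit (poly p) (c C) = orbit (poly p) (c D)"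
      have "c C \<in> orbit (poly p) (c C)" using has_period_orbit(4)[OF per_c[OF CD(1)]] .
      then have "(u, c C) \<in> C \<inter> D" using orb[OF CD(2)] c[OF CD(1)] CD(3) by auto
      then show "C = D"
        using CD orbit_cyclic_eq3[of f C "(u, c C)"] orbit_cyclic_eq3[of f D "(u, c C)"]
        by (auto simp: periodic_orbits_def)
    qed
    show "(\<lambda>C. orbit (poly p) (c C)) ` ?O \<subseteq> {D \<in> periodic_orbits (poly p) UNIV. card D = k}"
      using has_period_orbit(3,5)[OF per_c] by (auto simp: periodic_orbits_def)
  qed (rule fin)
qed

lemma return_period_eq_iff:
  assumes C: "cyclic_on (vmap S) C" and l: "0 < card (unique_cycle M)"
  shows "(\<forall>x\<in>C. return_period M S x = real k) \<longleftrightarrow> card C = card (unique_cycle M) * k"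
proof -
  have "return_period M S x = real k \<longleftrightarrow> card C = card (unique_cycle M) * k" if "x \<in> C" for x
  proof -
    have "exact_period (vmap S) x = card C"
      using cyclic_on_has_period[OF C that] by (rule has_period_exact_period)
    then have "return_period M S x = real k
        \<longleftrightarrow> real (card C) = real (card (unique_cycle M) * k)"
      using l by (simp add: return_period_def field_simps)
    then show ?thesis by (simp only: of_nat_eq_iff)
  qed
  then show ?thesis using C by (auto simp: cyclic_on_def)
qed

theorem theoremA:
  fixes M :: "'v mapping_schema"
    and f :: "'v \<times> complex \<Rightarrow> 'v \<times> complex"
    and A :: "('v \<times> complex) set"
    and S :: "('v \<times> complex) mapping_schema"
  assumes "mapping_schema M"
    and "connected_schema M"
    and "\<exists>u\<in>unique_cycle M. critical_vertex M u"
    and "f \<in> poly_maps M"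
    and "postcritically_finite M f"
    and "finite A"
    and "A \<subseteq> vertices M \<times> UNIV"
    and "f ` A \<subseteq> A"
    and "critical_points M f \<subseteq> A"
    and "S = postcritical_schema f A"
  shows "(\<forall>u\<in>vertices M. \<forall>v\<in>fibre S (vmap M u).
            (\<Sum>v'\<in>{v'\<in>fibre S u. f v' = v}. degree_at S v') \<le> degree_at M u) \<and>
         (\<forall>k\<ge>1. card {C \<in> periodic_orbits (vmap S) (vertices S).
                        \<forall>x\<in>C. return_period M S x = real k}
                 \<le> num_power_orbits (cycle_degree M) k)"
proof (intro conjI ballI allI impI)
  fix u v assume "u \<in> vertices M"
  then show "(\<Sum>v'\<in>{v'\<in>fibre S u. f v' = v}. degree_at S v') \<le> degree_at M u"
    unfolding assms(10) by (rule sum_degrees_over_preimage_le[OF assms(4)])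
next
  fix k :: nat assume k: "1 \<le> k"
  let ?l = "card (unique_cycle M)"
  obtain u where u: "u \<in> unique_cycle M" using assms(3) by blast
  have l: "0 < ?l"
    using u unique_cycle(1)[OF assms(1,2)]
    by (auto simp: periodic_orbits_def card_gt_0_iff intro: finite_cyclic_on)
  obtain p where deg: "degree p = cycle_degree M"
    and p: "\<And>j z. (f ^^ (?l * j)) (u, z) = (u, (poly p ^^ j) z)"
    using first_return_poly[OF assms(1,2,4) u] by blast
  have deg2: "2 \<le> degree p" using two_le_cycle_degree[OF assms(1-3)] deg by simp
  have "{C \<in> periodic_orbits (vmap S) (vertices S). \<forall>x\<in>C. return_period M S x = real k}
      = {C \<in> periodic_orbits f A. card C = ?l * k}"
    using return_period_eq_iff[of S _ M k, OF _ l]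
    by (auto simp: assms(10) postcritical_schema_def periodic_orbits_def)
  also have "card \<dots> \<le> card {D \<in> periodic_orbits (poly p) UNIV. card D = k}"
    using k by (intro card_orbits_le_first_return[OF assms(1,2,4,7) u p]
        orbits_mult_period(1) finite_periodic_points(2)[OF deg2]) auto
  also have "\<dots> \<le> num_power_orbits (cycle_degree M) k"
    using card_periodic_orbits_poly_le[OF deg2, of k] k deg by simp
  finally show "card {C \<in> periodic_orbits (vmap S) (vertices S).
      \<forall>x\<in>C. return_period M S x = real k} \<le> num_power_orbits (cycle_degree M) k" .
qed

end
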